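(* Let $R=\mathbb{Z}[u,v,w,x,y,z]$ be the polynomial ring with integer coefficients in six indeterminates, and set $$\Delta_1=vz-wy,\qquad \Delta_2=wx-uz,\qquad \Delta_3=uy-vx.$$ Then for each integer $k\ge 0$ the following identity holds in the localization $R_{\Delta_1\Delta_2\Delta_3}$ (equivalently, in the fraction field of $R$): $$ \begin{aligned} &\sum_{i,j\ge0}\binom{k}{i+j}\binom{k+i}{k}\binom{k+j}{k}\frac{(-wx)^i(vx)^j\,u^{k+1}}{\Delta_2^{k+1+i}\,\Delta_3^{k+1+j}}\\ &\quad+\sum_{i,j\ge0}\binom{k}{i+j}\binom{k+i}{k}\binom{k+j}{k}\frac{(-uy)^i(wy)^j\,v^{k+1}}{\Delta_3^{k+1+i}\,\Delta_1^{k+1+j}}\\ &\quad+\sum_{i,j\ge0}\binom{k}{i+j}\binom{k+i}{k}\binom{k+j}{k}\frac{(-vz)^i(uz)^j\,w^{k+1}}{\Delta_1^{k+1+i}\,\Delta_2^{k+1+j}} \;=\;0. \end{aligned} $$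
   Context: The elements $\Delta_1,\Delta_2,\Delta_3$ are (up to sign) the size $2$ minors of the matrix $\begin{pmatrix} u&v&w\\ x&y&z\end{pmatrix}$ of indeterminates. The sums run over all pairs of nonnegative integers $(i,j)$. For nonnegative integers $m,l$, the binomial coefficient $\binom{m}{l}$ is taken to be $0$ when $m<l$; hence each sum is finite (only pairs with $i+j\le k$ contribute). Zeroth powers are equal to $1$. *)

theory Defs
  imports
    "HOL-Library.Poly_Mapping"
    "HOL-Computational_Algebra.Fraction_Field"
begin

datatype indet = Iu | Iv | Iw | Ix | Iy | Iz

text \<open>
  The order on the indeterminates has no mathematical content; the library requires it to make
  the polynomial ring below an instance of \<^class>\<open>idom\<close>, so that its fraction field is available.
\<close>

primrec indet_index :: "indet \<Rightarrow> nat" where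
  "indet_index Iu = 0"
| "indet_index Iv = 1"
| "indet_index Iw = 2"
| "indet_index Ix = 3"
| "indet_index Iy = 4"
| "indet_index Iz = 5"

lemma indet_index_eq_iff: "indet_index a = indet_index b \<longleftrightarrow> a = b"
  by (cases a; cases b; simp)

instantiation indet :: linorder
begin

definition less_eq_indet :: "indet \<Rightarrow> indet \<Rightarrow> bool" where
  "less_eq_indet a b \<longleftrightarrow> indet_index a \<le> indet_index b"

definition less_indet :: "indet \<Rightarrow> indet \<Rightarrow> bool" where
  "less_indet a b \<longleftrightarrow> indet_index a < indet_index b"

instance
  by standard (auto simp: less_eq_indet_def less_indet_def indet_index_eq_iff[symmetric])

end

text \<open>
  The ring \<open>\<int>[u,v,w,x,y,z]\<close>: monomials are finitely supported exponent functions on the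
  indeterminates, and polynomials are finitely supported integer-valued functions on monomials,
  multiplied by convolution.
\<close>

type_synonym zpoly = "(indet \<Rightarrow>\<^sub>0 nat) \<Rightarrow>\<^sub>0 int"

definition indet_poly :: "indet \<Rightarrow> zpoly" where
  "indet_poly a = Poly_Mapping.single (Poly_Mapping.single a 1) 1"

end

theory Submission
  imports
    "HOL-Computational_Algebra.Formal_Laurent_Series"
    "HOL-Computational_Algebra.Polynomial_Factorial"
    Defs
begin

text \<open>
  The three double sums are, up to one common factor, the residues of the rational function
  \[ f(s) = \frac{s^k}{(s + x/u)^{k+1} (s + y/v)^{k+1} (s + z/w)^{k+1}} \]
  at its three poles \<open>- x/u\<close>, \<open>- y/v\<close>, \<open>- z/w\<close>. The differences of the poles are
  \<open>\<Delta>3/(uv)\<close>, \<open>\<Delta>1/(vw)\<close> and \<open>\<Delta>2/(uw)\<close> up to sign, so the poles are distinct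
  because the minors are nonzero. The denominator of \<open>f\<close> has degree \<open>3k + 3\<close>, at least two more
  than its numerator; hence \<open>f\<close> has no residue at infinity, and the sum of its residues vanishes.

  The residue theorem for rational functions with split denominator is proved algebraically in
  \<open>sum_residues_eq_0\<close>, over an arbitrary field: expand at each point as a formal Laurent
  series, and reduce the function by partial fractions until only pure powers \<open>1/(s - a)^n\<close>
  remain. The residue at one pole of order \<open>k + 1\<close> is the coefficient of \<open>X^k\<close> in a product of one
  binomial and two negative binomial series, which are the three binomial coefficients
  in the summand (\<open>residue_formula\<close>, \<open>residue_eq_double_sum\<close>). Clearing the common factor
  \<open>(- u v w)^(k+1)\<close> gives the identity for elements of any field such that \<open>u\<close>, \<open>v\<close>, \<open>w\<close> and
  the minors are nonzero (\<open>double_sum_cyclic_eq_0\<close>), in particular for the indeterminates in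
  the field of fractions of the polynomial ring.
\<close>

section \<open>Residues of rational functions with split denominator\<close>

text \<open>
  The factor \<open>s - a\<close> in the local coordinate \<open>X = s - p\<close>.
\<close>

definition local_factor :: "'a::field \<Rightarrow> 'a \<Rightarrow> 'a fls" where
  "local_factor p a = fls_X + fls_const (p - a)"

text \<open>
  The expansion at \<open>p\<close> of \<open>s^m / \<Prod>(s - a)\<close>. The roots form a multiset, so that inductions can
  remove one factor at a time whatever its multiplicity.
\<close>

definition laurent_expansion :: "nat \<Rightarrow> 'a::field multiset \<Rightarrow> 'a \<Rightarrow> 'a fls" where
  "laurent_expansion m A p = (fls_X + fls_const p) ^ m / (\<Prod>a\<in>#A. local_factor p a)"

lemma local_factor_nonzero: "local_factor p a \<noteq> 0"
proof -
  have "fls_nth (local_factor p a) 1 = 1" by (simp add: local_factor_def)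
  then show ?thesis by auto
qed

lemma denominator_nonzero: "(\<Prod>a\<in>#A. local_factor p a) \<noteq> 0"
  by (induction A) (simp_all add: local_factor_nonzero)

lemma residue_local_factor_power:
  assumes "n > 0"
  shows "fls_residue (1 / local_factor p a ^ n) = (if p = a \<and> n = 1 then 1 else 0)"
proof (cases "p = a")
  case True
  have "1 / local_factor p a ^ n = fls_X_inv ^ n"
    using True by (simp add: local_factor_def divide_inverse fls_inverse_X_power)
  then show ?thesis using True assms
    by (simp add: fls_X_inv_power_nth)
next
  case False
  have "fls_subdegree (local_factor p a) = 0"
    using False by (intro fls_subdegree_eqI) (auto simp: local_factor_def)
  then have "fls_subdegree (1 / local_factor p a ^ n) = 0"
    by (simp add: divide_inverse fls_inverse_subdegree fls_subdegree_pow)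
  then have "fls_residue (1 / local_factor p a ^ n) = 0"
    by (intro fls_residue_power_series) simp
  then show ?thesis using False by simp
qed

text \<open>
  One step of partial fractions: \<open>(s - a) - (s - b)\<close> is the nonzero constant \<open>b - a\<close>.
\<close>

lemma laurent_expansion_split:
  assumes "a \<noteq> b"
  shows "laurent_expansion 0 (add_mset a (add_mset b Q)) p =
    fls_const (inverse (b - a)) * (laurent_expansion 0 (add_mset b Q) p - laurent_expansion 0 (add_mset a Q) p)"
proof -
  let ?a = "local_factor p a" and ?b = "local_factor p b" and ?q = "(\<Prod>c\<in>#Q. local_factor p c)"
  have d: "?a - ?b = fls_const (b - a)" by (rule fls_eqI) (simp add: local_factor_def)
  have "1 / (?b * ?q) - 1 / (?a * ?q) = (?a - ?b) / (?a * (?b * ?q))"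
    using local_factor_nonzero[of p a] local_factor_nonzero[of p b] denominator_nonzero[of p Q]
    by (simp add: field_simps)
  moreover have "fls_const (inverse (b - a)) * fls_const (b - a) = 1"
    using assms by simp
  ultimately show ?thesis
    unfolding laurent_expansion_def d by (simp flip: mult.assoc)
qed

text \<open>
  Substituting \<open>s = (s - a) + a\<close> in one factor of the numerator either cancels a factor of the
  denominator or leaves it alone. In both cases the numerator drops in degree, while the
  denominator keeps at least the excess of two over it.
\<close>

lemma laurent_expansion_Suc:
  "laurent_expansion (Suc m) (add_mset a Q) p =
    laurent_expansion m Q p + fls_const a * laurent_expansion m (add_mset a Q) p"
proof -
  let ?a = "local_factor p a" and ?q = "(\<Prod>c\<in>#Q. local_factor p c)" and ?s = "fls_X + fls_const p"
  have "?s = ?a + fls_const a" by (intro fls_eqI) (simp add: local_factor_def)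
  then have "?s ^ Suc m / (?a * ?q) = (?a + fls_const a) * ?s ^ m / (?a * ?q)" by simp
  also have "\<dots> = ?s ^ m / ?q + fls_const a * (?s ^ m / (?a * ?q))"
    using local_factor_nonzero[of p a] denominator_nonzero[of p Q]
    by (simp add: field_simps)
  finally show ?thesis by (simp add: laurent_expansion_def)
qed

text \<open>
  Splitting off two distinct roots writes the sum as a difference of two sums of the same kind; for
  two simple poles these are \<open>1 - 1\<close>, which is why the exceptional value for a single simple pole
  is part of the induction. What remains are the powers \<open>1/(s - a)^n\<close>. Summing over a fixed
  set \<open>S\<close> containing the roots, rather than over the roots themselves, keeps the range of summation
  the same when a root disappears.
\<close>

lemma sum_residues_reciprocal:
  assumes "finite S" "set_mset A \<subseteq> S" "A \<noteq> {#}"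
  shows "(\<Sum>p\<in>S. fls_residue (laurent_expansion 0 A p)) = (if size A = 1 then 1 else 0)"
  using assms(2,3)
proof (induction "size A" arbitrary: A rule: less_induct)
  case less
  show ?case
  proof (cases "\<exists>a\<in>#A. \<exists>b\<in>#A. a \<noteq> b")
    case True
    then obtain a b Q where A: "A = add_mset a (add_mset b Q)" and ab: "a \<noteq> b"
      by (metis insert_DiffM insert_noteq_member)
    have "(\<Sum>p\<in>S. fls_residue (laurent_expansion 0 A p)) = inverse (b - a) *
       ((\<Sum>p\<in>S. fls_residue (laurent_expansion 0 (add_mset b Q) p)) - (\<Sum>p\<in>S. fls_residue (laurent_expansion 0 (add_mset a Q) p)))"
      unfolding A laurent_expansion_split[OF ab]
      by (simp add: sum_distrib_left sum_subtractf right_diff_distrib)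
    also have "\<dots> = 0"
      using less.hyps[of "add_mset b Q"] less.hyps[of "add_mset a Q"] less.prems A by simp
    finally show ?thesis using A by simp
  next
    case False
    from less.prems obtain a where a: "a \<in># A" by auto
    then have A: "A = replicate_mset (size A) a"
      using False by (metis set_mset_subset_singletonD singletonI subsetI)
    have n: "size A > 0" using less.prems by (simp add: nonempty_has_size)
    have e: "laurent_expansion 0 A p = 1 / local_factor p a ^ size A" for p
      by (subst A) (simp add: laurent_expansion_def)
    show ?thesis using a less.prems assms(1)
      unfolding e residue_local_factor_power[OF n] by (auto simp: sum.delta)
  qed
qed

lemma sum_residues_eq_0:
  assumes "finite S" "set_mset A \<subseteq> S" "m + 2 \<le> size A"
  shows "(\<Sum>p\<in>S. fls_residue (laurent_expansion m A p)) = 0"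
  using assms(2,3)
proof (induction m arbitrary: A)
  case 0
  then have "A \<noteq> {#}" by auto
  then show ?case using sum_residues_reciprocal[OF assms(1) 0(1)] 0(2) by auto
next
  case (Suc m)
  then obtain a Q where A: "A = add_mset a Q" by (cases A) auto
  have "(\<Sum>p\<in>S. fls_residue (laurent_expansion (Suc m) A p)) = (\<Sum>p\<in>S. fls_residue (laurent_expansion m Q p)) + a * (\<Sum>p\<in>S. fls_residue (laurent_expansion m A p))"
    unfolding A laurent_expansion_Suc by (simp add: sum.distrib sum_distrib_left)
  then show ?case using Suc.IH[of Q] Suc.IH[of A] Suc.prems A by simp
qed

section \<open>The residue at one pole\<close>

definition negative_binomial_series :: "nat \<Rightarrow> 'a::comm_ring_1 \<Rightarrow> 'a fps" where
  "negative_binomial_series n c = Abs_fps (\<lambda>i. of_nat ((n + i) choose n) * c ^ i)"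

text \<open>
  Multiplying by \<open>1 - c X\<close> lowers the exponent by one, by the Pascal recurrence. Arguing this
  way instead of with generalised binomial coefficients keeps the field of arbitrary
  characteristic.
\<close>

lemma negative_binomial_series:
  "(1 - fps_const c * fps_X) ^ Suc n * negative_binomial_series n c = 1"
proof (induction n)
  case 0
  show ?case
    by (rule fps_ext) (auto simp: negative_binomial_series_def algebra_simps fps_X_mult_nth power_eq_if)
next
  case (Suc n)
  have "(1 - fps_const c * fps_X) * negative_binomial_series (Suc n) c = negative_binomial_series n c"
  proof (rule fps_ext)
    fix i
    show "((1 - fps_const c * fps_X) * negative_binomial_series (Suc n) c) $ i = negative_binomial_series n c $ i"
      by (cases i) (simp_all add: negative_binomial_series_def binomial_eq_0 algebra_simps)
  qed
  then show ?case using Suc by (metis (no_types) mult.assoc mult.commute power_Suc)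
qed

lemma inverse_shifted_X_power:
  fixes d :: "'a::field"
  assumes "d \<noteq> 0"
  shows "(fps_X + fps_const d) ^ Suc n *
     (fps_const (inverse d ^ Suc n) * negative_binomial_series n (- inverse d)) = 1"
proof -
  have "fps_X + fps_const d = fps_const d * (1 - fps_const (- inverse d) * fps_X)"
    using assms by (simp add: algebra_simps flip: mult.assoc)
  then have "(fps_X + fps_const d) ^ Suc n = fps_const (d ^ Suc n) * (1 - fps_const (- inverse d) * fps_X) ^ Suc n"
    by (simp only: power_mult_distrib fps_const_power)
  moreover have "fps_const (d ^ Suc n) * fps_const (inverse d ^ Suc n) = 1"
    using assms by (simp add: field_simps)
  ultimately show ?thesis
    using negative_binomial_series[of "- inverse d" n]
    by (metis (no_types, lifting) mult.assoc mult.left_commute mult.right_neutral)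
qed

lemma shifted_X_power_nth:
  fixes p :: "'a::comm_ring_1"
  shows "((fps_X + fps_const p) ^ k) $ n = of_nat (k choose n) * p ^ (k - n)"
proof -
  have "((fps_X + fps_const p) ^ k) $ n =
      (\<Sum>l\<le>k. (fps_const (of_nat (k choose l) * p ^ (k - l)) * fps_X ^ l) $ n)"
    by (simp add: binomial_ring fps_sum_nth fps_of_nat[symmetric] mult_ac del: fps_const_mult flip: fps_const_power fps_const_mult)
  also have "\<dots> = (\<Sum>l\<le>k. if l = n then of_nat (k choose l) * p ^ (k - l) else 0)"
    by (intro sum.cong) (auto simp: fps_X_power_nth)
  also have "\<dots> = of_nat (k choose n) * p ^ (k - n)"
    by (simp add: sum.delta binomial_eq_0)
  finally show ?thesis .
qed

text \<open>
  At \<open>s = a + X\<close> the function is \<open>X^(-k-1)\<close> times \<open>(X + a)^k (X + a - b)^(-k-1) (X + a - c)^(-k-1)\<close>,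
  so its residue is the coefficient of \<open>X^k\<close>: the last two factors contribute \<open>X^j\<close> and \<open>X^i\<close>, and
  \<open>(X + a)^k\<close> contributes \<open>X^(k-i-j)\<close> with coefficient \<open>binomial(k, i+j) a^(i+j)\<close>.
\<close>

lemma residue_formula:
  fixes a b c :: "'a::field"
  assumes "a \<noteq> b" "a \<noteq> c"
  shows "fls_residue (laurent_expansion k (replicate_mset (Suc k) a + replicate_mset (Suc k) b + replicate_mset (Suc k) c) a) =
    (\<Sum>(i, j)\<in>{(i, j). i + j \<le> k}.
       of_nat ((k choose (i + j)) * ((k + i) choose k) * ((k + j) choose k)) *
       ((- a) ^ i * (- a) ^ j / ((a - c) ^ (k + 1 + i) * (a - b) ^ (k + 1 + j))))"
proof -
  define I where "I d = fps_const (inverse d ^ Suc k) * negative_binomial_series k (- inverse d)" for d :: 'a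
  have I_nth: "I d $ i = of_nat ((k + i) choose k) * ((- 1) ^ i / d ^ (k + 1 + i))" for d i
    by (simp add: I_def negative_binomial_series_def divide_inverse power_add power_inverse power_minus[of "inverse d"])
  have I: "1 / local_factor a r ^ Suc k = fps_to_fls (I (a - r))" if "a \<noteq> r" for r
  proof -
    have "local_factor a r ^ Suc k * fps_to_fls (I (a - r)) = fps_to_fls ((fps_X + fps_const (a - r)) ^ Suc k * I (a - r))"
      by (simp only: fls_times_fps_to_fls fps_to_fls_power fps_to_fls_plus fps_const_to_fls fps_X_to_fls local_factor_def)
    also have "\<dots> = 1"
      unfolding I_def using that by (subst inverse_shifted_X_power) simp_all
    finally show ?thesis
      using local_factor_nonzero[of a r] by (simp add: divide_eq_eq mult.commute)
  qed
  let ?P = "(fps_X + fps_const a) ^ k"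
  have "laurent_expansion k (replicate_mset (Suc k) a + replicate_mset (Suc k) b + replicate_mset (Suc k) c) a
      = (fls_X + fls_const a) ^ k * (1 / local_factor a c ^ Suc k) * (1 / local_factor a b ^ Suc k) / local_factor a a ^ Suc k"
    by (simp add: laurent_expansion_def mult_ac)
  also have "\<dots> = fps_to_fls (I (a - c) * I (a - b) * ?P) * fls_X_inv ^ Suc k"
    unfolding I[OF assms(1)] I[OF assms(2)]
    by (simp add: fls_times_fps_to_fls fps_to_fls_power local_factor_def divide_inverse fls_inverse_X_power mult_ac del: power_Suc)
  finally have "fls_residue (laurent_expansion k (replicate_mset (Suc k) a + replicate_mset (Suc k) b + replicate_mset (Suc k) c) a)
      = (I (a - c) * I (a - b) * ?P) $ k"
    by (simp only: fls_X_inv_power_times_conv_shift fls_residue_def) simp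
  also have "\<dots> = (\<Sum>n\<le>k. \<Sum>i\<le>n. I (a - c) $ i * I (a - b) $ (n - i) * (of_nat (k choose n) * a ^ n))"
    unfolding fps_mult_nth[of "I (a - c) * I (a - b)"] atLeast0AtMost
  proof (intro sum.cong refl)
    fix n assume "n \<in> {..k}"
    then have "?P $ (k - n) = of_nat (k choose n) * a ^ n"
      by (simp add: shifted_X_power_nth binomial_symmetric[symmetric])
    then show "(I (a - c) * I (a - b)) $ n * ?P $ (k - n) = (\<Sum>i\<le>n. I (a - c) $ i * I (a - b) $ (n - i) * (of_nat (k choose n) * a ^ n))"
      by (simp add: fps_mult_nth atLeast0AtMost sum_distrib_right)
  qed
  also have "\<dots> = (\<Sum>n\<le>k. \<Sum>i\<le>n. I (a - c) $ i * I (a - b) $ (n - i) * (of_nat (k choose (i + (n - i))) * a ^ (i + (n - i))))"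
    by (intro sum.cong) auto
  also have "\<dots> = (\<Sum>(i, j)\<in>{(i, j). i + j \<le> k}. I (a - c) $ i * I (a - b) $ j * (of_nat (k choose (i + j)) * a ^ (i + j)))"
    by (rule sum.triangle_reindex_eq[symmetric])
  also have "\<dots> = (\<Sum>(i, j)\<in>{(i, j). i + j \<le> k}.
       of_nat ((k choose (i + j)) * ((k + i) choose k) * ((k + j) choose k)) *
       ((- a) ^ i * (- a) ^ j / ((a - c) ^ (k + 1 + i) * (a - b) ^ (k + 1 + j))))"
    unfolding I_nth by (intro sum.cong) (auto simp: power_add power_minus[of a] mult_ac)
  finally show ?thesis .
qed

section \<open>The identity in a field\<close>

definition double_sum :: "nat \<Rightarrow> 'a::field \<Rightarrow> 'a \<Rightarrow> 'a \<Rightarrow> 'a \<Rightarrow> 'a \<Rightarrow> 'a \<Rightarrow> 'a" where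
  "double_sum k u v w x y z = (\<Sum>(i, j)\<in>{(i, j). i + j \<le> k}.
     of_nat ((k choose (i + j)) * ((k + i) choose k) * ((k + j) choose k)) *
     ((- (w * x)) ^ i * (v * x) ^ j * u ^ (k + 1) /
       ((w * x - u * z) ^ (k + 1 + i) * (u * y - v * x) ^ (k + 1 + j))))"

text \<open>
  With \<open>a = - x/u\<close>, \<open>b = - y/v\<close>, \<open>c = - z/w\<close> one has \<open>a - c = - \<Delta>2/(uw)\<close> and \<open>a - b = \<Delta>3/(uv)\<close>, so
  that \<open>- a/(a - c) = - wx/\<Delta>2\<close> and \<open>- a/(a - b) = vx/\<Delta>3\<close> are the quantities raised to the
  powers \<open>i\<close> and \<open>j\<close>.
\<close>

lemma residue_eq_double_sum:
  fixes u v w x y z :: "'a::field"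
  assumes nz: "u \<noteq> 0" "v \<noteq> 0" "w \<noteq> 0"
    and D2: "w * x - u * z \<noteq> 0" and D3: "u * y - v * x \<noteq> 0"
  shows "fls_residue (laurent_expansion k (replicate_mset (Suc k) (- x / u) +
      replicate_mset (Suc k) (- y / v) + replicate_mset (Suc k) (- z / w)) (- x / u)) =
    (- (u * v * w)) ^ (k + 1) * double_sum k u v w x y z"
proof -
  let ?a = "- x / u" and ?b = "- y / v" and ?c = "- z / w"
  let ?D2 = "w * x - u * z" and ?D3 = "u * y - v * x"
  have ac: "?a - ?c = - (?D2 / (u * w))" and ab: "?a - ?b = ?D3 / (u * v)"
    using nz by (simp_all add: field_simps)
  have ne: "?a \<noteq> ?b" "?a \<noteq> ?c"
    using ac ab nz D2 D3 by fastforce+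
  have ic: "1 / (?a - ?c) = - (u * w) / ?D2" "- ?a / (?a - ?c) = - (w * x) / ?D2"
    unfolding ac using nz D2 by (simp_all add: divide_simps)
  have ib: "1 / (?a - ?b) = u * v / ?D3" "- ?a / (?a - ?b) = v * x / ?D3"
    unfolding ab using nz D3 by (simp_all add: divide_simps)
  have split: "s ^ i / t ^ (n + i) = (1 / t) ^ n * (s / t) ^ i" for s t :: 'a and n i
    by (simp add: power_add power_divide)
  have term_eq: "(- ?a) ^ i * (- ?a) ^ j / ((?a - ?c) ^ (k + 1 + i) * (?a - ?b) ^ (k + 1 + j)) =
      (- (u * v * w)) ^ (k + 1) * ((- (w * x)) ^ i * (v * x) ^ j * u ^ (k + 1) /
       (?D2 ^ (k + 1 + i) * ?D3 ^ (k + 1 + j)))" for i j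
  proof -
    have "(- ?a) ^ i * (- ?a) ^ j / ((?a - ?c) ^ (k + 1 + i) * (?a - ?b) ^ (k + 1 + j)) =
       ((1 / (?a - ?c)) ^ (k + 1) * (- ?a / (?a - ?c)) ^ i) * ((1 / (?a - ?b)) ^ (k + 1) * (- ?a / (?a - ?b)) ^ j)"
      by (simp only: split[symmetric] times_divide_times_eq)
    also have "\<dots> = ((- (u * w)) ^ (k + 1) * (u * v) ^ (k + 1)) * ((- (w * x)) ^ i * (v * x) ^ j) / (?D2 ^ (k + 1 + i) * ?D3 ^ (k + 1 + j))"
      unfolding ic ib power_add[of _ "k + 1"] power_divide by (simp only: times_divide_times_eq mult_ac)
    also have "(- (u * w)) ^ (k + 1) * (u * v) ^ (k + 1) = (- (u * v * w)) ^ (k + 1) * u ^ (k + 1)"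
      by (simp only: power_mult_distrib[symmetric]) (simp add: mult_ac)
    finally show ?thesis by (simp add: mult_ac)
  qed
  show ?thesis
    unfolding residue_formula[OF ne] term_eq double_sum_def
    by (simp add: sum_distrib_left case_prod_unfold mult_ac)
qed

text \<open>
  The factor relating residue and double sum is invariant under the cyclic permutation of the
  three columns, so the vanishing of the sum of residues passes to the double sums.
\<close>

lemma double_sum_cyclic_eq_0:
  fixes u v w x y z :: "'a::field"
  assumes nz: "u \<noteq> 0" "v \<noteq> 0" "w \<noteq> 0"
    and D: "v * z - w * y \<noteq> 0" "w * x - u * z \<noteq> 0" "u * y - v * x \<noteq> 0"
  shows "double_sum k u v w x y z + double_sum k v w u y z x + double_sum k w u v z x y = 0"
proof -
  let ?a = "- x / u" and ?b = "- y / v" and ?c = "- z / w"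
  let ?n = "Suc k"
  let ?A = "replicate_mset ?n ?a + replicate_mset ?n ?b + replicate_mset ?n ?c"
  have distinct: "?a \<noteq> ?b" "?b \<noteq> ?c" "?a \<noteq> ?c"
    using nz D by (auto simp: field_simps)
  have "(\<Sum>p\<in>{?a, ?b, ?c}. fls_residue (laurent_expansion k ?A p)) = 0"
    by (rule sum_residues_eq_0) auto
  moreover have "(\<Sum>p\<in>{?a, ?b, ?c}. fls_residue (laurent_expansion k ?A p)) =
      fls_residue (laurent_expansion k ?A ?a) + fls_residue (laurent_expansion k ?A ?b) + fls_residue (laurent_expansion k ?A ?c)"
    using distinct by simp
  moreover have "fls_residue (laurent_expansion k ?A ?a) = (- (u * v * w)) ^ (k + 1) * double_sum k u v w x y z"
    using nz D by (intro residue_eq_double_sum)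
  moreover have "fls_residue (laurent_expansion k ?A ?b) = (- (u * v * w)) ^ (k + 1) * double_sum k v w u y z x"
    using residue_eq_double_sum[OF nz(2,3,1) D(3,1), of k] by (simp only: ac_simps)
  moreover have "fls_residue (laurent_expansion k ?A ?c) = (- (u * v * w)) ^ (k + 1) * double_sum k w u v z x y"
    using residue_eq_double_sum[OF nz(3,1,2) D(1,2), of k] by (simp only: ac_simps)
  ultimately have "(- (u * v * w)) ^ (k + 1) *
      (double_sum k u v w x y z + double_sum k v w u y z x + double_sum k w u v z x y) = 0"
    by (simp only: distrib_left)
  then show ?thesis using nz by simp
qed

section \<open>The fraction field of the polynomial ring\<close>

lemma to_fract_power: "to_fract (a ^ n) = to_fract a ^ n"
  by (induction n) simp_all

lemma Sum_any_eq_double_sum: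
  fixes u v w x y z :: "'a::idom"
  shows "Sum_any (\<lambda>(i, j).
      of_nat ((k choose (i + j)) * ((k + i) choose k) * ((k + j) choose k)) *
      Fract ((- (w * x)) ^ i * (v * x) ^ j * u ^ (k + 1))
            ((w * x - u * z) ^ (k + 1 + i) * (u * y - v * x) ^ (k + 1 + j))) =
    double_sum k (to_fract u) (to_fract v) (to_fract w) (to_fract x) (to_fract y) (to_fract z)"
    (is "Sum_any ?f = _")
proof -
  have fin: "finite {(i, j). i + j \<le> k}"
    by (rule finite_subset[of _ "{..k} \<times> {..k}"]) auto
  have "Sum_any ?f = sum ?f {(i, j). i + j \<le> k}"
    by (rule Sum_any.expand_superset[OF fin]) (auto simp: binomial_eq_0 intro: ccontr)
  then show ?thesis
    unfolding double_sum_def Fract_conv_to_fract by (simp only: to_fract_power to_fract_mult to_fract_diff to_fract_uminus)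
qed

lemma indet_poly_mult: "indet_poly a * indet_poly b = Poly_Mapping.single (Poly_Mapping.single a 1 + Poly_Mapping.single b 1) 1"
  by (simp add: indet_poly_def mult_single)

text \<open>
  The two monomials differ, since the first involves \<open>a\<close> and the second does not.
\<close>

lemma minor_nonzero:
  assumes "a \<noteq> c" "a \<noteq> d"
  shows "indet_poly a * indet_poly b - indet_poly c * indet_poly d \<noteq> 0"
proof
  assume "indet_poly a * indet_poly b - indet_poly c * indet_poly d = 0"
  then have "Poly_Mapping.single a (1::nat) + Poly_Mapping.single b 1 = Poly_Mapping.single c 1 + Poly_Mapping.single d 1"
    unfolding indet_poly_mult by (metis lookup_single_eq lookup_single_not_eq eq_iff_diff_eq_0 one_neq_zero)
  then have "Poly_Mapping.lookup (Poly_Mapping.single a (1::nat) + Poly_Mapping.single b 1) a = Poly_Mapping.lookup (Poly_Mapping.single c 1 + Poly_Mapping.single d 1) a"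
    by simp
  then show False using assms by (simp add: lookup_add lookup_single_not_eq)
qed

lemma indet_poly_nonzero: "indet_poly a \<noteq> 0"
  by (simp add: indet_poly_def)

theorem mainTheorem1:
  fixes k :: nat
  shows
    "let u = indet_poly Iu; v = indet_poly Iv; w = indet_poly Iw;
         x = indet_poly Ix; y = indet_poly Iy; z = indet_poly Iz;
         \<Delta>1 = v * z - w * y;
         \<Delta>2 = w * x - u * z;
         \<Delta>3 = u * y - v * x
     in
       Sum_any (\<lambda>(i, j).
         of_nat ((k choose (i + j)) * ((k + i) choose k) * ((k + j) choose k)) *
         Fract ((- (w * x)) ^ i * (v * x) ^ j * u ^ (k + 1))
               (\<Delta>2 ^ (k + 1 + i) * \<Delta>3 ^ (k + 1 + j)))
     + Sum_any (\<lambda>(i, j).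
         of_nat ((k choose (i + j)) * ((k + i) choose k) * ((k + j) choose k)) *
         Fract ((- (u * y)) ^ i * (w * y) ^ j * v ^ (k + 1))
               (\<Delta>3 ^ (k + 1 + i) * \<Delta>1 ^ (k + 1 + j)))
     + Sum_any (\<lambda>(i, j).
         of_nat ((k choose (i + j)) * ((k + i) choose k) * ((k + j) choose k)) *
         Fract ((- (v * z)) ^ i * (u * z) ^ j * w ^ (k + 1))
               (\<Delta>1 ^ (k + 1 + i) * \<Delta>2 ^ (k + 1 + j)))
     = (0 :: zpoly fract)"
proof -
  define u v w x y z where vars: "u = indet_poly Iu" "v = indet_poly Iv" "w = indet_poly Iw"
    "x = indet_poly Ix" "y = indet_poly Iy" "z = indet_poly Iz"
  have nz: "u \<noteq> 0" "v \<noteq> 0" "w \<noteq> 0"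
    by (simp_all add: vars indet_poly_nonzero)
  have D: "v * z - w * y \<noteq> 0" "w * x - u * z \<noteq> 0" "u * y - v * x \<noteq> 0"
    unfolding vars by (rule minor_nonzero; simp)+
  have D': "to_fract v * to_fract z - to_fract w * to_fract y \<noteq> 0"
    "to_fract w * to_fract x - to_fract u * to_fract z \<noteq> 0"
    "to_fract u * to_fract y - to_fract v * to_fract x \<noteq> 0"
    using D by (simp_all flip: to_fract_mult to_fract_diff)
  show ?thesis
    unfolding Let_def vars[symmetric] Sum_any_eq_double_sum
    using nz D' by (intro double_sum_cyclic_eq_0) simp_all
qed

end
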